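(* Let $Y$ be a vertex algebra structure on the chiral boson. Given finite sets $S_1,S_2\subset\mathbb P\setminus P$, states $\mathtt v_1\in{}_{S_1}\mathbf W$ and $\mathtt v_2\in{}_{S_2}\mathbf W$, and a translation $v$ with $S_2\cap(S_1+v)=\emptyset$ (so that both sides are defined), one has $$Y(\mathtt v_1,v)\mathtt v_2=\mathsf T_v\,Y(\mathtt v_2,-v)\mathtt v_1 .$$
   Context: Fix a point $P$ of a complex projective line $\mathbb P$. Translations are the automorphisms in the additive group ($\cong\mathbb C$) of translations of the affine line $\mathbb P\setminus P$; $z+v$ is the action of $v$ on $z$; in a coordinate $u$ with pole at $P$, $u(z+v)=u(z)+u(v)$. $\mathbf K$ is the space of meromorphic 1-forms on $\mathbb P$ with all residues zero, regular at $P$; $\mathbf W=S^*\mathbf K$, vacuum $\mathbf 1$. For a finite set $S\subset\mathbb P\setminus P$: ${}_S\mathbf W=S^*({}_S\mathbf K)$ with ${}_S\mathbf K\subset\mathbf K$ the forms with all poles in $S$; $\mathbf W^S=S^*(\mathbf K^S)$ with $\mathbf K^S\subset\mathbf K$ the forms regular at every point of $S$. $\mathsf T_v:\mathbf W\to\mathbf W$ is induced by $a(u)du\mapsto a(u-u(v))du$ and maps ${}_S\mathbf W$ to ${}_{S+v}\mathbf W$. For $O\ne P$ and $\lambda\in\mathbb C^*=\mathrm{Aut}_{O,P}(\mathbb P)$ acting by $u(\lambda(z))=\lambda u(z)$ (with $u(O)=0$, $u(P)=\infty$), $\mathsf R_\lambda$ is the operator on $\mathbf W$ induced by pull-back by $\lambda^{-1}$.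 A vertex algebra structure on the chiral boson is an assignment, linear in the state, to each finite set $S$, state $\mathtt v\in{}_S\mathbf W$ and translation $v$ of an operator $Y(\mathtt v,v):\mathbf W^{S+v}\to\mathbf W$ (compatible with enlarging $S$), such that: 1. if $\mathtt v'\in{}_{S'}\mathbf W\cap\mathbf W^{S+v}$ then $Y(\mathtt v,v)\mathtt v'\in{}_{S'\cup(S+v)}\mathbf W$; 2. $Y(\mathbf 1,v)=\mathrm{Id}$; 3. $Y(\mathtt v,0)\mathbf 1=\mathtt v$; 4. for $\mathtt v\in{}_S\mathbf W$, $\mathtt v'\in{}_{S'}\mathbf W$, the operators $Y(\mathtt v,v)$ and $Y(\mathtt v',v')$ commute if $S+v$ is disjoint from $S'+v'$ (where both compositions are defined); 5. $Y(\mathtt v,v+v')=\mathsf T_{v'}\circ Y(\mathtt v,v)\circ\mathsf T_{-v'}$ for translations $v,v'$; 6. $Y$ is $\mathrm{Aut}_P(\mathbb P)$-covariant: $Y(\mathsf T_{v'}\mathtt v,v)=\mathsf T_{v'}Y(\mathtt v,v)\mathsf T_{-v'}$ and $Y(\mathsf R_\lambda\mathtt v,\lambda v)=\mathsf R_\lambda Y(\mathtt v,v)\mathsf R_{\lambda^{-1}}$ for rotations $\lambda$ about any point $O$; 7. for a fixed point $O$, the vectors $Y(\mathtt v_n,v_n)\cdots Y(\mathtt v_1,v_1)\mathbf 1$, over all sequences of distinct translations $v_i$ and states $\mathtt v_i\in{}_{\{O\}}\mathbf W$, span $\mathbf W$. *)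

theory Defs
  imports "HOL-Complex_Analysis.Complex_Analysis" "HOL-Library.Poly_Mapping" "HOL-Library.Multiset"
begin

text \<open>
  We fix an affine coordinate \<open>u\<close> on the projective line with pole at \<open>P\<close>. It identifies
  the affine line \<open>\<P> \<setminus> P\<close> with the type \<^typ>\<open>complex\<close>, \<open>P\<close> with the point at infinity, and
  a translation \<open>v\<close> with the complex number \<open>u(v)\<close>, acting by \<open>z \<mapsto> z + v\<close>.
\<close>

section \<open>The space \<open>K\<close> of 1-forms\<close>

text \<open>
  A 1-form \<open>a(u) du\<close> is represented by its coefficient \<open>a\<close>, normalised to take the value \<open>0\<close> at
  its poles so that equality of forms is equality of functions. In the coordinate \<open>w = 1/u\<close>
  at \<open>P\<close> the form reads \<open>- a(1/w) w\<^sup>-\<^sup>2 dw\<close>, and regularity at \<open>P\<close> says that this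
  coefficient extends holomorphically to \<open>w = 0\<close>.
\<close>

definition regular_at_P :: "(complex \<Rightarrow> complex) \<Rightarrow> bool" where
  "regular_at_P a \<longleftrightarrow>
     (\<exists>h. h analytic_on {0} \<and> (\<forall>\<^sub>F w in at 0. - a (1 / w) / w\<^sup>2 = h w))"

definition K_coeff :: "(complex \<Rightarrow> complex) \<Rightarrow> bool" where
  "K_coeff a \<longleftrightarrow> a nicely_meromorphic_on UNIV \<and> (\<forall>z. residue a z = 0) \<and> regular_at_P a"

lemma K_coeff_meromorphic: "K_coeff a \<Longrightarrow> a meromorphic_on UNIV"
  by (simp add: K_coeff_def nicely_meromorphic_on_def)

lemma meromorphic_UNIV_isolated:
  "a meromorphic_on UNIV \<Longrightarrow> isolated_singularity_at a z"
  by (meson UNIV_I meromorphic_on_isolated_singularity meromorphic_on_subset subset_UNIV)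

lemma K_coeff_cmult:
  assumes "K_coeff a"
  shows "K_coeff (\<lambda>z. c * a z)"
proof -
  have "residue (\<lambda>z. c * a z) z = 0" for z
  proof -
    obtain r where r: "r > 0" "a analytic_on ball z r - {z}"
      using meromorphic_UNIV_isolated[OF K_coeff_meromorphic[OF assms], of z]
      by (auto simp: isolated_singularity_at_def)
    have "residue (\<lambda>z. c * a z) z = c * residue a z"
      by (rule residue_lmul[of "ball z r"]) (use r analytic_imp_holomorphic in auto)
    then show ?thesis using assms by (simp add: K_coeff_def)
  qed
  moreover have "regular_at_P (\<lambda>z. c * a z)"
  proof -
    obtain h where h: "h analytic_on {0}" "\<forall>\<^sub>F w in at 0. - a (1 / w) / w\<^sup>2 = h w"
      using assms by (auto simp: K_coeff_def regular_at_P_def)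
    have "\<forall>\<^sub>F w in at 0. - (c * a (1 / w)) / w\<^sup>2 = c * h w"
      using h(2)
    proof eventually_elim
      case (elim w)
      have "- (c * a (1 / w)) / w\<^sup>2 = c * (- a (1 / w) / w\<^sup>2)" by simp
      then show ?case using elim by metis
    qed
    moreover have "(\<lambda>w. c * h w) analytic_on {0}"
      using h(1) by (intro analytic_intros)
    ultimately show ?thesis unfolding regular_at_P_def by blast
  qed
  ultimately show ?thesis
    using assms by (auto simp: K_coeff_def)
qed

lemma K_coeff_add:
  assumes "K_coeff a" "K_coeff b"
  shows "K_coeff (remove_sings (\<lambda>z. a z + b z))"
proof -
  have m: "(\<lambda>z. a z + b z) meromorphic_on UNIV"
    using assms by (intro meromorphic_intros) (auto simp: K_coeff_meromorphic)
  have "residue (remove_sings (\<lambda>z. a z + b z)) z = 0" for z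
  proof -
    obtain r where r: "r > 0" "a analytic_on ball z r - {z}"
      using meromorphic_UNIV_isolated[OF K_coeff_meromorphic[OF assms(1)], of z]
      by (auto simp: isolated_singularity_at_def)
    obtain s where s: "s > 0" "b analytic_on ball z s - {z}"
      using meromorphic_UNIV_isolated[OF K_coeff_meromorphic[OF assms(2)], of z]
      by (auto simp: isolated_singularity_at_def)
    let ?B = "ball z (min r s)"
    have "residue (\<lambda>z. a z + b z) z = residue a z + residue b z"
    proof (rule residue_add[of ?B])
      show "a holomorphic_on ?B - {z}"
        using r(2) by (rule analytic_imp_holomorphic[OF analytic_on_subset]) auto
      show "b holomorphic_on ?B - {z}"
        using s(2) by (rule analytic_imp_holomorphic[OF analytic_on_subset]) auto
    qed (use r s in auto)
    then show ?thesis
      using assms meromorphic_UNIV_isolated[OF m] by (simp add: K_coeff_def)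
  qed
  moreover have "regular_at_P (remove_sings (\<lambda>z. a z + b z))"
  proof -
    obtain h where h: "h analytic_on {0}" "\<forall>\<^sub>F w in at 0. - a (1 / w) / w\<^sup>2 = h w"
      using assms by (auto simp: K_coeff_def regular_at_P_def)
    obtain k where k: "k analytic_on {0}" "\<forall>\<^sub>F w in at 0. - b (1 / w) / w\<^sup>2 = k w"
      using assms by (auto simp: K_coeff_def regular_at_P_def)
    let ?s = "\<lambda>z. a z + b z"
    have hk: "(\<lambda>w. h w + k w) analytic_on {0}"
      using h(1) k(1) by (intro analytic_intros)
    \<comment> \<open>near infinity the sum is analytic, so normalising it changes nothing there\<close>
    have ev: "\<forall>\<^sub>F w in at 0. ?s (1 / w) = - w\<^sup>2 * (h w + k w)"
      using h(2) k(2) eventually_neq_at_within[of 0 0 UNIV]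
    proof eventually_elim
      case (elim w)
      have "- a (1 / w) = h w * w\<^sup>2" "- b (1 / w) = k w * w\<^sup>2"
        using elim by (auto simp: divide_simps)
      then have "- ?s (1 / w) = (h w + k w) * w\<^sup>2"
        by (simp add: algebra_simps)
      then have "?s (1 / w) = - ((h w + k w) * w\<^sup>2)"
        by (metis minus_minus)
      then show ?case by (simp add: algebra_simps)
    qed
    obtain A where A: "open A" "0 \<in> A" "(\<lambda>w. h w + k w) holomorphic_on A"
      using hk by (auto simp: analytic_at)
    obtain V where V: "open V" "0 \<in> V"
      "\<And>w. w \<in> V \<Longrightarrow> w \<noteq> 0 \<Longrightarrow> ?s (1 / w) = - w\<^sup>2 * (h w + k w)"
      using ev unfolding eventually_at_topological by auto
    define U where "U = A \<inter> V"
    have U: "open U" "0 \<in> U"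
      "\<And>w. w \<in> U - {0} \<Longrightarrow> ?s (1 / w) = - w\<^sup>2 * (h w + k w)"
      "\<And>w. w \<in> U - {0} \<Longrightarrow> (\<lambda>w. h w + k w) analytic_on {w}"
      using A V by (auto simp: U_def analytic_at)
    have eq: "remove_sings ?s (1 / w) = ?s (1 / w)" if w: "w \<in> U - {0}" for w
    proof -
      let ?g = "\<lambda>z. - (1 / z)\<^sup>2 * (h (1 / z) + k (1 / z))"
      have "((\<lambda>w. h w + k w) \<circ> (\<lambda>z. 1 / z)) analytic_on {1 / w}"
      proof (rule analytic_on_compose)
        show "(\<lambda>z. 1 / z) analytic_on {1 / w}"
          using w by (intro analytic_intros) auto
      qed (use U(4)[OF w] in simp)
      then have "(\<lambda>z. h (1 / z) + k (1 / z)) analytic_on {1 / w}"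
        by (simp add: o_def)
      moreover have "(\<lambda>z. - (1 / z)\<^sup>2) analytic_on {1 / w}"
        using w by (intro analytic_intros) auto
      ultimately have gan: "?g analytic_on {1 / w}"
        by (rule analytic_on_mult[rotated])
      have "isCont (\<lambda>z. 1 / z) (1 / w)"
        using w by (intro continuous_intros) auto
      then have "filterlim (\<lambda>z. 1 / z) (nhds w) (nhds (1 / w))"
        unfolding isCont_def tendsto_at_iff_tendsto_nhds by simp
      moreover have "\<forall>\<^sub>F z in nhds w. z \<in> U - {0}"
        using w U(1) by (intro eventually_nhds_in_open open_delete) auto
      ultimately have "\<forall>\<^sub>F z in nhds (1 / w). 1 / z \<in> U - {0}"
        by (rule eventually_compose_filterlim[rotated])
      then have "\<forall>\<^sub>F z in nhds (1 / w). ?s z = ?g z"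
      proof eventually_elim
        case (elim z)
        show ?case using U(3)[OF elim] by simp
      qed
      then have "?s analytic_on {1 / w}"
        using gan analytic_at_cong[OF _ refl] by simp
      then show ?thesis by (rule remove_sings_at_analytic)
    qed
    have "\<forall>\<^sub>F w in at 0. w \<in> U - {0}"
      using U by (intro eventually_at_in_open) auto
    then have "\<forall>\<^sub>F w in at 0. - remove_sings ?s (1 / w) / w\<^sup>2 = h w + k w"
    proof eventually_elim
      case (elim w)
      then show ?case using eq[OF elim] U(3)[OF elim] by simp
    qed
    then show ?thesis using hk unfolding regular_at_P_def by blast
  qed
  ultimately show ?thesis
    using remove_sings_nicely_meromorphic[OF m] by (simp add: K_coeff_def)
qed

typedef form = "{a. K_coeff a}" morphisms coeff Form
proof
  have "regular_at_P (\<lambda>_. 0)"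
    unfolding regular_at_P_def by (rule exI[of _ "\<lambda>_. 0"]) auto
  then show "(\<lambda>_. 0) \<in> {a. K_coeff a}"
    by (auto simp: K_coeff_def residue_const)
qed

setup_lifting type_definition_form

lemma K_coeff_eqI:
  assumes "K_coeff a" "K_coeff b" "\<And>z. \<forall>\<^sub>F w in at z. a w = b w"
  shows "a = b"
proof
  fix z
  have "remove_sings f z = f z" if "K_coeff f" for f
    using that unfolding K_coeff_def nicely_meromorphic_on_def by (metis UNIV_I remove_sings_at_pole remove_sings_eqI)
  then show "a z = b z"
    using remove_sings_cong[OF assms(3) refl] assms(1,2) by metis
qed

lemma eventually_remove_sings_add:
  assumes "K_coeff a" "K_coeff b"
  shows "\<forall>\<^sub>F w in at z. remove_sings (\<lambda>z. a z + b z) w = a w + b w"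
proof -
  have "(\<lambda>z. a z + b z) meromorphic_on UNIV"
    using assms by (intro meromorphic_intros) (auto simp: K_coeff_meromorphic)
  then show ?thesis
    using eventually_remove_sings_eq_at meromorphic_UNIV_isolated by blast
qed

instantiation form :: ab_group_add
begin

lift_definition zero_form :: form is "\<lambda>_. 0"
  using K_coeff_cmult[OF coeff[simplified], of 0] by simp

lift_definition plus_form :: "form \<Rightarrow> form \<Rightarrow> form"
  is "\<lambda>a b. remove_sings (\<lambda>z. a z + b z)"
  by (rule K_coeff_add)

lift_definition uminus_form :: "form \<Rightarrow> form" is "\<lambda>a z. - a z"
  using K_coeff_cmult[of _ "-1"] by simp

definition minus_form :: "form \<Rightarrow> form \<Rightarrow> form" where "minus_form a b = a + - b"

instance
proof
  fix a b c :: form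
  show "a + b + c = a + (b + c)"
  proof transfer
    fix a b c :: "complex \<Rightarrow> complex"
    assume K: "K_coeff a" "K_coeff b" "K_coeff c"
    show "remove_sings (\<lambda>z. remove_sings (\<lambda>z. a z + b z) z + c z) =
          remove_sings (\<lambda>z. a z + remove_sings (\<lambda>z. b z + c z) z)"
    proof (rule K_coeff_eqI)
      fix z
      show "\<forall>\<^sub>F w in at z. remove_sings (\<lambda>z. remove_sings (\<lambda>z. a z + b z) z + c z) w =
          remove_sings (\<lambda>z. a z + remove_sings (\<lambda>z. b z + c z) z) w"
        using eventually_remove_sings_add[OF K(1,2), of z]
          eventually_remove_sings_add[OF K(2,3), of z]
          eventually_remove_sings_add[OF K_coeff_add[OF K(1,2)] K(3), of z]
          eventually_remove_sings_add[OF K(1) K_coeff_add[OF K(2,3)], of z]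
        by eventually_elim simp
    qed (use K in \<open>auto intro!: K_coeff_add\<close>)
  qed
  show "a + b = b + a"
    by transfer (simp add: add.commute)
  show "0 + a = a"
  proof transfer
    fix a assume a: "K_coeff a"
    have "K_coeff (\<lambda>_. 0)" using K_coeff_cmult[OF a, of 0] by simp
    then show "remove_sings (\<lambda>z. 0 + a z) = a"
      using K_coeff_add[OF _ a, of "\<lambda>_. 0"] eventually_remove_sings_add[OF _ a, of "\<lambda>_. 0"] a
      by (intro K_coeff_eqI) auto
  qed
  show "- a + a = 0"
    by transfer (simp add: remove_sings_eqI fun_eq_iff)
  show "a - b = a + - b" by (simp add: minus_form_def)
qed

end

lift_definition scaleK :: "complex \<Rightarrow> form \<Rightarrow> form" is "\<lambda>c a z. c * a z"
  by (rule K_coeff_cmult)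

lemma scaleK_add: "scaleK c (a + b) = scaleK c a + scaleK c b"
proof transfer
  fix c and a b :: "complex \<Rightarrow> complex"
  assume K: "K_coeff a" "K_coeff b"
  show "(\<lambda>z. c * remove_sings (\<lambda>z. a z + b z) z) = remove_sings (\<lambda>z. c * a z + c * b z)"
  proof (rule K_coeff_eqI)
    fix z
    show "\<forall>\<^sub>F w in at z. c * remove_sings (\<lambda>z. a z + b z) w =
        remove_sings (\<lambda>z. c * a z + c * b z) w"
      using eventually_remove_sings_add[OF K, of z]
        eventually_remove_sings_add[OF K[THEN K_coeff_cmult[of _ c]], of z]
      by eventually_elim (simp add: algebra_simps)
  qed (use K in \<open>auto intro!: K_coeff_add K_coeff_cmult\<close>)
qed

lemma scaleK_add_left: "scaleK (c + d) a = scaleK c a + scaleK d a"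
proof transfer
  fix c d and a :: "complex \<Rightarrow> complex"
  assume K: "K_coeff a"
  show "(\<lambda>z. (c + d) * a z) = remove_sings (\<lambda>z. c * a z + d * a z)"
  proof (rule K_coeff_eqI)
    fix z
    show "\<forall>\<^sub>F w in at z. (c + d) * a w = remove_sings (\<lambda>z. c * a z + d * a z) w"
      using eventually_remove_sings_add[OF K_coeff_cmult[OF K, of c] K_coeff_cmult[OF K, of d], of z]
      by eventually_elim (simp add: algebra_simps)
  qed (use K in \<open>auto intro!: K_coeff_add K_coeff_cmult\<close>)
qed

global_interpretation K: vector_space scaleK
proof
  fix a b :: form and x y :: complex
  show "scaleK x (a + b) = scaleK x a + scaleK x b" by (rule scaleK_add)
  show "scaleK (x + y) a = scaleK x a + scaleK y a" by (rule scaleK_add_left)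
  show "scaleK x (scaleK y a) = scaleK (x * y) a" by transfer (simp add: mult.assoc)
  show "scaleK 1 a = a" by transfer simp
qed

definition poles :: "form \<Rightarrow> complex set" where
  "poles a = {z. is_pole (coeff a) z}"

text \<open>\<open>K_poles_in S\<close> and \<open>K_regular_on S\<close> are \<open>\<^sub>SK\<close> and \<open>K\<^sup>S\<close>.\<close>

definition K_poles_in :: "complex set \<Rightarrow> form set" where
  "K_poles_in S = {a. poles a \<subseteq> S}"

definition K_regular_on :: "complex set \<Rightarrow> form set" where
  "K_regular_on S = {a. poles a \<inter> S = {}}"

subsection \<open>Affine changes of coordinate\<close>

lemma filtermap_affine_at:
  fixes m t z :: complex
  assumes "m \<noteq> 0"
  shows "filtermap (\<lambda>z. m * z + t) (at z) = at (m * z + t)"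
proof (rule filtermap_fun_inverse[where g = "\<lambda>x. (x - t) / m"])
  show "filterlim (\<lambda>x. (x - t) / m) (at z) (at (m * z + t))"
    using assms by (auto simp: filterlim_at eventually_at_filter field_simps intro!: tendsto_eq_intros)
  show "filterlim (\<lambda>z. m * z + t) (at (m * z + t)) (at z)"
    using assms by (auto simp: filterlim_at eventually_at_filter intro!: tendsto_eq_intros)
  show "\<forall>\<^sub>F x in at (m * z + t). m * ((x - t) / m) + t = x"
    using assms by auto
qed

lemma eventually_at_affine:
  fixes m t z :: complex
  assumes "m \<noteq> 0" "\<And>z. \<forall>\<^sub>F w in at z. Q w"
  shows "\<forall>\<^sub>F w in at z. Q (m * w + t)"
  using assms(2)[of "m * z + t"] unfolding filtermap_affine_at[OF assms(1), symmetric]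
  by (simp add: eventually_filtermap)

lemma residue_affine:
  fixes m t :: complex
  assumes "m \<noteq> 0" "a meromorphic_on UNIV"
  shows "residue (\<lambda>z. m * a (m * z + t)) z = residue a (m * z + t)"
proof -
  obtain F where F: "(\<lambda>x. a (m * z + t + x)) has_laurent_expansion F"
    using assms(2) unfolding meromorphic_on_def by blast
  define G where "G = fps_const m * fps_X"
  have "((\<lambda>x. a (m * z + t + x)) \<circ> (\<lambda>x. m * x)) has_laurent_expansion fls_compose_fps F G"
  proof (rule has_laurent_expansion_compose[OF F])
    have "(\<lambda>x. m * x) has_fps_expansion G"
      unfolding G_def by (intro fps_expansion_intros)
    then show "(\<lambda>x. m * x) has_laurent_expansion fps_to_fls G"
      by (rule has_laurent_expansion_fps)
    show "fps_nth G 0 = 0" "G \<noteq> 0"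
      using assms(1) by (auto simp: G_def fps_eq_iff intro!: exI[of _ 1])
  qed
  then have "(\<lambda>x. m * a (m * (z + x) + t)) has_laurent_expansion fls_const m * fls_compose_fps F G"
    by (intro has_laurent_expansion_cmult_left) (simp add: o_def algebra_simps)
  then have "residue (\<lambda>z. m * a (m * z + t)) z = fls_residue (fls_const m * fls_compose_fps F G)"
    by (rule has_laurent_expansion_residue)
  also have "\<dots> = fls_residue F"
  proof -
    let ?n = "fls_subdegree F" and ?P = "fls_base_factor_to_fps F"
    have G: "fps_to_fls G = fls_const m * fls_X"
      by (simp add: G_def fls_times_fps_to_fls)
    have "fls_const m * fls_compose_fps F G =
        fls_const (m * m powi ?n) * (fps_to_fls (fps_compose ?P G) * fls_X_intpow ?n)"
      unfolding fls_compose_fps_def G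
      by (simp add: power_int_mult_distrib fls_X_power_int fls_const_power_int
          fls_const_mult_const[symmetric] mult_ac)
    also have "\<dots> = fls_const (m * m powi ?n) * fls_shift (- ?n) (fps_to_fls (fps_compose ?P G))"
      by (simp only: fls_X_intpow_times_conv_shift)
    finally have "fls_residue (fls_const m * fls_compose_fps F G) =
        m * m powi ?n * fls_nth (fps_to_fls (fps_compose ?P G)) (- 1 - ?n)"
      by simp
    also have "\<dots> = fls_nth F (- 1)"
    proof (cases "?n \<le> - 1")
      case True
      then have "fls_nth (fps_to_fls (fps_compose ?P G)) (- 1 - ?n) =
          m ^ nat (- 1 - ?n) * fls_nth F (- 1)"
        by (simp add: G_def)
      moreover have "m ^ nat (- 1 - ?n) = m powi (- 1 - ?n)"
        using True by (simp add: power_int_def)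
      moreover have "m * m powi ?n * m powi (- 1 - ?n) = 1"
        using assms(1) by (simp add: power_int_diff power_int_minus)
      ultimately show ?thesis by (metis mult.assoc mult_1)
    qed simp
    finally show ?thesis by simp
  qed
  also have "\<dots> = residue a (m * z + t)"
    using has_laurent_expansion_residue[OF F] by simp
  finally show ?thesis .
qed

lemma K_coeff_affine:
  assumes "K_coeff a"
  shows "K_coeff (\<lambda>z. m * a (m * z + t))"
proof (cases "m = 0")
  case True
  then show ?thesis using K_coeff_cmult[OF assms, of 0] by simp
next
  case m: False
  have mero: "(\<lambda>z. m * a (m * z + t)) meromorphic_on UNIV"
    by (intro meromorphic_intros meromorphic_on_compose[OF K_coeff_meromorphic[OF assms]] analytic_intros) auto
  have "(is_pole (\<lambda>z. m * a (m * z + t)) z \<and> m * a (m * z + t) = 0) \<or>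
        (\<lambda>z. m * a (m * z + t)) \<midarrow>z\<rightarrow> m * a (m * z + t)" for z
  proof -
    have "(is_pole a (m * z + t) \<and> a (m * z + t) = 0) \<or> a \<midarrow>m * z + t\<rightarrow> a (m * z + t)"
      using assms by (auto simp: K_coeff_def nicely_meromorphic_on_def)
    then show ?thesis
    proof
      assume "is_pole a (m * z + t) \<and> a (m * z + t) = 0"
      then show ?thesis
        using is_pole_compose_iff[OF filtermap_affine_at[OF m], of a t z] m by (simp add: o_def)
    next
      assume "a \<midarrow>m * z + t\<rightarrow> a (m * z + t)"
      then have "(\<lambda>z. a (m * z + t)) \<midarrow>z\<rightarrow> a (m * z + t)"
        unfolding filtermap_affine_at[OF m, symmetric] filterlim_filtermap .
      then show ?thesis by (intro disjI2 tendsto_intros)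
    qed
  qed
  moreover have "residue (\<lambda>z. m * a (m * z + t)) z = 0" for z
    using residue_affine[OF m K_coeff_meromorphic[OF assms]] assms by (simp add: K_coeff_def)
  moreover have "regular_at_P (\<lambda>z. m * a (m * z + t))"
  proof -
    obtain h where h: "h analytic_on {0}" "\<forall>\<^sub>F w in at 0. - a (1 / w) / w\<^sup>2 = h w"
      using assms by (auto simp: K_coeff_def regular_at_P_def)
    \<comment> \<open>the same affine map, in the coordinate \<open>w = 1/u\<close>\<close>
    let ?\<phi> = "\<lambda>w. w / (m + t * w)"
    have "\<forall>\<^sub>F w in nhds 0. m + t * w \<noteq> 0"
    proof -
      have "((\<lambda>w. m + t * w) \<longlongrightarrow> m + t * 0) (nhds 0)"
        by (intro tendsto_intros filterlim_ident)
      then show ?thesis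
        using m by (intro tendsto_imp_eventually_ne) auto
    qed
    then have nz: "\<forall>\<^sub>F w in at 0. w \<noteq> 0 \<and> m + t * w \<noteq> 0"
      by (auto simp: eventually_at_filter elim: eventually_mono)
    have "?\<phi> \<midarrow>0\<rightarrow> 0" using m by (auto intro!: tendsto_eq_intros)
    then have "filterlim ?\<phi> (at 0) (at 0)"
      using nz by (auto simp: filterlim_at elim: eventually_mono)
    from eventually_compose_filterlim[OF h(2) this] nz
    have "\<forall>\<^sub>F w in at 0. - (m * a (m * (1 / w) + t)) / w\<^sup>2 = m * h (?\<phi> w) / (m + t * w)\<^sup>2"
    proof eventually_elim
      case (elim w)
      have "1 / ?\<phi> w = m * (1 / w) + t" using elim by (simp add: add_divide_distrib)
      then have "h (?\<phi> w) = - a (m * (1 / w) + t) * (m + t * w)\<^sup>2 / w\<^sup>2"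
        using elim by (simp add: power_divide)
      then show ?case using elim by simp
    qed
    moreover have "(\<lambda>w. m * h (?\<phi> w) / (m + t * w)\<^sup>2) analytic_on {0}"
    proof -
      have "h \<circ> ?\<phi> analytic_on {0}"
        using h(1) m by (intro analytic_on_compose analytic_intros) auto
      then have "(\<lambda>w. h (?\<phi> w)) analytic_on {0}" by (simp add: o_def)
      then show ?thesis using m by (intro analytic_intros) auto
    qed
    ultimately show ?thesis unfolding regular_at_P_def by blast
  qed
  ultimately show ?thesis
    using mero by (simp add: K_coeff_def nicely_meromorphic_on_def)
qed

lift_definition translate_form :: "complex \<Rightarrow> form \<Rightarrow> form" is "\<lambda>v a u. a (u - v)"
  using K_coeff_affine[where m = 1 and t = "- v" for v] by simp

text \<open>Pull-back by the inverse of the rotation \<open>u \<mapsto> p + \<mu> (u - p)\<close> about the point \<open>p\<close>.\<close>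

lift_definition rotate_form :: "complex \<Rightarrow> complex \<Rightarrow> form \<Rightarrow> form"
  is "\<lambda>p \<mu> a u. a (p + (u - p) / \<mu>) / \<mu>"
proof -
  fix p l :: complex and a :: "complex \<Rightarrow> complex"
  assume "K_coeff a"
  from K_coeff_affine[OF this, of "1 / l" "p - p / l"]
  show "K_coeff (\<lambda>u. a (p + (u - p) / l) / l)"
    by (simp add: diff_divide_distrib algebra_simps)
qed

lemma K_coeff_add_affine:
  assumes "K_coeff a" "K_coeff b" "m \<noteq> 0"
  shows "(\<lambda>u. m * remove_sings (\<lambda>z. a z + b z) (m * u + t)) =
         remove_sings (\<lambda>u. m * a (m * u + t) + m * b (m * u + t))"
proof (rule K_coeff_eqI)
  fix z
  note K = assms(1,2)[THEN K_coeff_affine[of _ m t]]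
  show "\<forall>\<^sub>F u in at z. m * remove_sings (\<lambda>z. a z + b z) (m * u + t) =
      remove_sings (\<lambda>u. m * a (m * u + t) + m * b (m * u + t)) u"
    using eventually_remove_sings_add[OF K, of z]
      eventually_at_affine[OF assms(3) eventually_remove_sings_add[OF assms(1,2)], of t z]
    by eventually_elim (simp add: algebra_simps)
qed (use assms in \<open>auto intro!: K_coeff_affine K_coeff_add\<close>)

lemma linear_translate_form: "Vector_Spaces.linear scaleK scaleK (translate_form v)"
proof -
  have "translate_form v (a + b) = translate_form v a + translate_form v b" for a b
  proof transfer
    fix v and a b :: "complex \<Rightarrow> complex"
    assume K: "K_coeff a" "K_coeff b"
    show "(\<lambda>u. remove_sings (\<lambda>z. a z + b z) (u - v)) = remove_sings (\<lambda>z. a (z - v) + b (z - v))"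
      using K_coeff_add_affine[OF K, of 1 "- v"] by simp
  qed
  moreover have "translate_form v (scaleK c a) = scaleK c (translate_form v a)" for c a
    by transfer simp
  ultimately show ?thesis
    by (simp add: Vector_Spaces.linear_iff K.vector_space_axioms)
qed

lemma linear_rotate_form:
  assumes "\<mu> \<noteq> 0"
  shows "Vector_Spaces.linear scaleK scaleK (rotate_form p \<mu>)"
proof -
  have "rotate_form p \<mu> (a + b) = rotate_form p \<mu> a + rotate_form p \<mu> b" for a b
    using assms
  proof transfer
    fix p \<mu> :: complex and a b :: "complex \<Rightarrow> complex"
    assume K: "K_coeff a" "K_coeff b" and "\<mu> \<noteq> 0"
    have eq: "p + (u - p) / \<mu> = (1 / \<mu>) * u + (p - p / \<mu>)" for u
      by (simp add: diff_divide_distrib)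
    show "(\<lambda>u. remove_sings (\<lambda>z. a z + b z) (p + (u - p) / \<mu>) / \<mu>) =
        remove_sings (\<lambda>z. a (p + (z - p) / \<mu>) / \<mu> + b (p + (z - p) / \<mu>) / \<mu>)"
      using K_coeff_add_affine[OF K, of "1 / \<mu>" "p - p / \<mu>"] \<open>\<mu> \<noteq> 0\<close> unfolding eq by simp
  qed
  moreover have "rotate_form p \<mu> (scaleK c a) = scaleK c (rotate_form p \<mu> a)" for c a
    by transfer simp
  ultimately show ?thesis
    by (simp add: Vector_Spaces.linear_iff K.vector_space_axioms)
qed

section \<open>The symmetric algebra \<open>W = S\<^sup>* K\<close>\<close>

text \<open>
  \<open>S\<^sup>* K\<close> is the free commutative \<open>\<complex>\<close>-algebra on the underlying set of \<open>K\<close>, divided by the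
  smallest congruence that makes the inclusion of the generators \<open>\<complex>\<close>-linear. A monomial in the
  generators is a multiset of forms.
\<close>

type_synonym free_alg = "form multiset \<Rightarrow>\<^sub>0 complex"

abbreviation free_gen :: "form \<Rightarrow> free_alg" where
  "free_gen a \<equiv> Poly_Mapping.single {#a#} 1"

abbreviation free_const :: "complex \<Rightarrow> free_alg" where
  "free_const c \<equiv> Poly_Mapping.single {#} c"

inductive sym_rel :: "free_alg \<Rightarrow> free_alg \<Rightarrow> bool" where
  sym_rel_gen_add: "sym_rel (free_gen (a + b)) (free_gen a + free_gen b)"
| sym_rel_gen_scale: "sym_rel (free_gen (scaleK c a)) (free_const c * free_gen a)"
| sym_rel_refl: "sym_rel p p"
| sym_rel_sym: "sym_rel p q \<Longrightarrow> sym_rel q p"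
| sym_rel_trans: "sym_rel p q \<Longrightarrow> sym_rel q r \<Longrightarrow> sym_rel p r"
| sym_rel_add: "sym_rel p p' \<Longrightarrow> sym_rel q q' \<Longrightarrow> sym_rel (p + q) (p' + q')"
| sym_rel_mult: "sym_rel p p' \<Longrightarrow> sym_rel q q' \<Longrightarrow> sym_rel (p * q) (p' * q')"

quotient_type boson = free_alg / sym_rel
  by (intro equivpI reflpI sympI transpI)
    (blast intro: sym_rel_refl sym_rel_sym sym_rel_trans)+

lemma sym_rel_const_coeff:
  "sym_rel p q \<Longrightarrow> Poly_Mapping.lookup p {#} = Poly_Mapping.lookup q {#}"
proof (induction rule: sym_rel.induct)
  case (sym_rel_mult p p' q q')
  have "Poly_Mapping.lookup (f * g) {#} = Poly_Mapping.lookup f {#} * Poly_Mapping.lookup g {#}"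
    for f g :: free_alg
  proof -
    have *: "({#} = l + m) \<longleftrightarrow> l = {#} \<and> m = {#}" for l m :: "form multiset"
      by auto
    show ?thesis
      by (simp add: lookup_mult * when_when[symmetric] mult_when)
  qed
  then show ?case using sym_rel_mult by simp
qed (auto simp: lookup_add mult_single lookup_single)

instantiation boson :: comm_ring_1
begin

lift_definition zero_boson :: boson is 0 .
lift_definition one_boson :: boson is 1 .
lift_definition plus_boson :: "boson \<Rightarrow> boson \<Rightarrow> boson" is "(+)" by (rule sym_rel_add)
lift_definition times_boson :: "boson \<Rightarrow> boson \<Rightarrow> boson" is "(*)" by (rule sym_rel_mult)
lift_definition uminus_boson :: "boson \<Rightarrow> boson" is "uminus"
  using sym_rel_mult[OF sym_rel_refl[of "- 1"]] by fastforce
lift_definition minus_boson :: "boson \<Rightarrow> boson \<Rightarrow> boson" is "(-)"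
  using sym_rel_add[OF _ sym_rel_mult[OF sym_rel_refl[of "- 1"]]] by fastforce

instance
proof
  fix x y z :: boson
  show "x + y + z = x + (y + z)" by transfer (simp add: add.assoc sym_rel_refl)
  show "x + y = y + x" by transfer (simp add: add.commute sym_rel_refl)
  show "0 + x = x" by transfer (simp add: sym_rel_refl)
  show "- x + x = 0" by transfer (simp add: sym_rel_refl)
  show "x - y = x + - y" by transfer (simp add: sym_rel_refl)
  show "x * y * z = x * (y * z)" by transfer (simp add: mult.assoc sym_rel_refl)
  show "x * y = y * x" by transfer (simp add: mult.commute sym_rel_refl)
  show "1 * x = x" by transfer (simp add: sym_rel_refl)
  show "(x + y) * z = x * z + y * z" by transfer (simp add: distrib_right sym_rel_refl)
  show "(0::boson) \<noteq> 1"
  proof transfer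
    show "\<not> sym_rel 0 1"
      using sym_rel_const_coeff[of 0 1] by (auto simp: lookup_one)
  qed
qed

end

lift_definition scaleW :: "complex \<Rightarrow> boson \<Rightarrow> boson" is "\<lambda>c p. free_const c * p"
  by (intro sym_rel_mult sym_rel_refl)

global_interpretation W: vector_space scaleW
proof
  fix x y :: boson and c d :: complex
  show "scaleW c (x + y) = scaleW c x + scaleW c y"
    by transfer (simp add: distrib_left sym_rel_refl)
  show "scaleW (c + d) x = scaleW c x + scaleW d x"
    by transfer (simp add: single_add distrib_right sym_rel_refl)
  show "scaleW c (scaleW d x) = scaleW (c * d) x"
    by transfer (simp add: mult_single mult.assoc[symmetric] sym_rel_refl)
  show "scaleW 1 x = x"
    by transfer (simp add: sym_rel_refl)
qed

lift_definition gen :: "form \<Rightarrow> boson" is free_gen .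

text \<open>
  For a subspace \<open>U\<close> of \<open>K\<close> the natural map \<open>S\<^sup>* U \<rightarrow> S\<^sup>* K\<close> is injective, and we identify
  \<open>S\<^sup>* U\<close> with its image, the unital subalgebra generated by \<open>U\<close>.
\<close>

inductive_set sym_sub :: "form set \<Rightarrow> boson set" for U where
  sym_sub_gen: "a \<in> U \<Longrightarrow> gen a \<in> sym_sub U"
| sym_sub_one: "1 \<in> sym_sub U"
| sym_sub_scale: "x \<in> sym_sub U \<Longrightarrow> scaleW c x \<in> sym_sub U"
| sym_sub_add: "x \<in> sym_sub U \<Longrightarrow> y \<in> sym_sub U \<Longrightarrow> x + y \<in> sym_sub U"
| sym_sub_mult: "x \<in> sym_sub U \<Longrightarrow> y \<in> sym_sub U \<Longrightarrow> x * y \<in> sym_sub U"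

text \<open>\<open>W_poles_in S\<close> and \<open>W_regular_on S\<close> are \<open>\<^sub>SW\<close> and \<open>W\<^sup>S\<close>.\<close>

definition W_poles_in :: "complex set \<Rightarrow> boson set" where
  "W_poles_in S = sym_sub (K_poles_in S)"

definition W_regular_on :: "complex set \<Rightarrow> boson set" where
  "W_regular_on S = sym_sub (K_regular_on S)"

subsection \<open>Functoriality\<close>

definition free_map :: "(form \<Rightarrow> form) \<Rightarrow> free_alg \<Rightarrow> free_alg" where
  "free_map f p =
     (\<Sum>m\<in>Poly_Mapping.keys p. Poly_Mapping.single (image_mset f m) (Poly_Mapping.lookup p m))"

text \<open>The endomorphism \<open>S\<^sup>* f\<close> of the algebra \<open>W\<close>, for a linear endomorphism \<open>f\<close> of \<open>K\<close>.\<close>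

definition sym_map :: "(form \<Rightarrow> form) \<Rightarrow> boson \<Rightarrow> boson" where
  "sym_map f x = abs_boson (free_map f (rep_boson x))"

lemma free_map_superset:
  assumes "finite A" "Poly_Mapping.keys p \<subseteq> A"
  shows "free_map f p =
    (\<Sum>m\<in>A. Poly_Mapping.single (image_mset f m) (Poly_Mapping.lookup p m))"
  unfolding free_map_def using assms
  by (intro sum.mono_neutral_left) (auto simp: in_keys_iff)

lemma free_map_add: "free_map f (p + q) = free_map f p + free_map f q"
proof -
  let ?A = "Poly_Mapping.keys p \<union> Poly_Mapping.keys q"
  have "Poly_Mapping.keys (p + q) \<subseteq> ?A" by (rule keys_add)
  then show ?thesis
    by (simp add: free_map_superset[of ?A] lookup_add single_add sum.distrib)
qed

lemma free_map_0 [simp]: "free_map f 0 = 0"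
  by (simp add: free_map_def)

lemma free_map_single [simp]:
  "free_map f (Poly_Mapping.single m c) = Poly_Mapping.single (image_mset f m) c"
  by (subst free_map_superset[of "{m}"]) auto

lemma free_map_sum: "free_map f (sum g A) = (\<Sum>i\<in>A. free_map f (g i))"
  by (induction A rule: infinite_finite_induct) (auto simp: free_map_add)

lemma sum_single_keys:
  "(\<Sum>m\<in>Poly_Mapping.keys p. Poly_Mapping.single m (Poly_Mapping.lookup p m)) = p"
  by (rule poly_mapping_eqI)
    (auto simp: lookup_sum lookup_single when_def in_keys_iff)

lemma free_map_mult: "free_map f (p * q) = free_map f p * free_map f q"
proof -
  let ?s = "\<lambda>p m. Poly_Mapping.single m (Poly_Mapping.lookup p m) :: free_alg"
  have "free_map f (p * q) =
      free_map f ((\<Sum>m\<in>Poly_Mapping.keys p. ?s p m) * (\<Sum>n\<in>Poly_Mapping.keys q. ?s q n))"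
    by (simp only: sum_single_keys)
  also have "\<dots> = free_map f p * free_map f q"
    unfolding free_map_def[of f p] free_map_def[of f q]
    by (simp add: sum_product free_map_sum mult_single)
  finally show ?thesis .
qed

lemma sym_rel_free_map:
  assumes "Vector_Spaces.linear scaleK scaleK f" "sym_rel p q"
  shows "sym_rel (free_map f p) (free_map f q)"
  using assms(2)
proof induction
  case (sym_rel_gen_add a b)
  then show ?case
    using assms(1) by (simp add: free_map_add Vector_Spaces.linear_iff sym_rel.sym_rel_gen_add)
next
  case (sym_rel_gen_scale c a)
  then show ?case
    using assms(1) sym_rel.sym_rel_gen_scale[of c "f a"]
    by (simp add: free_map_mult Vector_Spaces.linear_iff)
qed (auto simp: free_map_add free_map_mult intro: sym_rel.intros)

lemma sym_map_abs:
  assumes "Vector_Spaces.linear scaleK scaleK f"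
  shows "sym_map f (abs_boson p) = abs_boson (free_map f p)"
proof -
  have "sym_rel (rep_boson (abs_boson p)) p"
    using Quotient_boson sym_rel_refl by (metis Quotient_rep_abs)
  then show ?thesis
    using sym_rel_free_map[OF assms] by (simp add: sym_map_def boson.abs_eq_iff)
qed

lemma sym_map_hom:
  assumes "Vector_Spaces.linear scaleK scaleK f"
  shows sym_map_gen: "sym_map f (gen a) = gen (f a)"
    and sym_map_one: "sym_map f 1 = 1"
    and sym_map_scale: "sym_map f (scaleW c x) = scaleW c (sym_map f x)"
    and sym_map_add: "sym_map f (x + y) = sym_map f x + sym_map f y"
    and sym_map_mult: "sym_map f (x * y) = sym_map f x * sym_map f y"
proof -
  show "sym_map f (gen a) = gen (f a)"
    by (simp add: gen.abs_eq sym_map_abs[OF assms])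
  show "sym_map f 1 = 1"
    by (simp add: one_boson.abs_eq sym_map_abs[OF assms] flip: single_one)
  show "sym_map f (scaleW c x) = scaleW c (sym_map f x)"
    by (induction x rule: boson.abs_induct)
      (simp add: scaleW.abs_eq sym_map_abs[OF assms] free_map_mult)
  show "sym_map f (x + y) = sym_map f x + sym_map f y"
    by (induction x rule: boson.abs_induct, induction y rule: boson.abs_induct)
      (simp add: plus_boson.abs_eq sym_map_abs[OF assms] free_map_add)
  show "sym_map f (x * y) = sym_map f x * sym_map f y"
    by (induction x rule: boson.abs_induct, induction y rule: boson.abs_induct)
      (simp add: times_boson.abs_eq sym_map_abs[OF assms] free_map_mult)
qed

definition T_op :: "complex \<Rightarrow> boson \<Rightarrow> boson" where
  "T_op v = sym_map (translate_form v)"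

definition R_op :: "complex \<Rightarrow> complex \<Rightarrow> boson \<Rightarrow> boson" where
  "R_op p \<mu> = sym_map (rotate_form p \<mu>)"

section \<open>Vertex algebra structures on the chiral boson\<close>

definition shift :: "complex \<Rightarrow> complex set \<Rightarrow> complex set" where
  "shift v S = (\<lambda>z. z + v) ` S"

text \<open>
  \<open>Y S x v\<close> is the operator \<open>Y(x, v)\<close> attached to the state \<open>x\<close> regarded as an element of
  \<open>\<^sub>SW\<close>; as \<open>Y S\<close> is a total function, its values for \<open>S\<close> infinite or \<open>x\<close> outside \<open>\<^sub>SW\<close>, and
  its values at vectors outside \<open>W\<^bsup>S+v\<^esup>\<close>, carry no meaning and are left unconstrained.
  In \<open>locality\<close> the last two premises say that both compositions are defined. In
  \<open>completeness\<close>, \<open>fold\<close> applies the head of the list first, so the last list entry acts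
  outermost; by \<open>covariance_T\<close> the choice of the point \<open>p\<close> is immaterial.
\<close>

locale vertex_algebra_structure =
  fixes Y :: "complex set \<Rightarrow> boson \<Rightarrow> complex \<Rightarrow> boson \<Rightarrow> boson"
  assumes op_add:
      "\<lbrakk>finite S; x \<in> W_poles_in S; w \<in> W_regular_on (shift v S); w' \<in> W_regular_on (shift v S)\<rbrakk>
        \<Longrightarrow> Y S x v (w + w') = Y S x v w + Y S x v w'"
    and op_scale:
      "\<lbrakk>finite S; x \<in> W_poles_in S; w \<in> W_regular_on (shift v S)\<rbrakk>
        \<Longrightarrow> Y S x v (scaleW c w) = scaleW c (Y S x v w)"
    and state_add:
      "\<lbrakk>finite S; x \<in> W_poles_in S; x' \<in> W_poles_in S; w \<in> W_regular_on (shift v S)\<rbrakk>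
        \<Longrightarrow> Y S (x + x') v w = Y S x v w + Y S x' v w"
    and state_scale:
      "\<lbrakk>finite S; x \<in> W_poles_in S; w \<in> W_regular_on (shift v S)\<rbrakk>
        \<Longrightarrow> Y S (scaleW c x) v w = scaleW c (Y S x v w)"
    and enlarge:
      "\<lbrakk>finite S'; S \<subseteq> S'; x \<in> W_poles_in S; w \<in> W_regular_on (shift v S')\<rbrakk>
        \<Longrightarrow> Y S' x v w = Y S x v w"
    and poles:
      "\<lbrakk>finite S; finite S'; x \<in> W_poles_in S; x' \<in> W_poles_in S' \<inter> W_regular_on (shift v S)\<rbrakk>
        \<Longrightarrow> Y S x v x' \<in> W_poles_in (S' \<union> shift v S)"
    and vacuum_left:
      "\<lbrakk>finite S; w \<in> W_regular_on (shift v S)\<rbrakk> \<Longrightarrow> Y S 1 v w = w"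
    and vacuum_right:
      "\<lbrakk>finite S; x \<in> W_poles_in S\<rbrakk> \<Longrightarrow> Y S x 0 1 = x"
    and locality:
      "\<lbrakk>finite S; finite S'; x \<in> W_poles_in S; x' \<in> W_poles_in S'; shift v S \<inter> shift v' S' = {};
        w \<in> W_regular_on (shift v S); w \<in> W_regular_on (shift v' S');
        Y S' x' v' w \<in> W_regular_on (shift v S); Y S x v w \<in> W_regular_on (shift v' S')\<rbrakk>
        \<Longrightarrow> Y S x v (Y S' x' v' w) = Y S' x' v' (Y S x v w)"
    and translation:
      "\<lbrakk>finite S; x \<in> W_poles_in S; w \<in> W_regular_on (shift (v + v') S)\<rbrakk>
        \<Longrightarrow> Y S x (v + v') w = T_op v' (Y S x v (T_op (- v') w))"
    and covariance_T:
      "\<lbrakk>finite S; x \<in> W_poles_in S; w \<in> W_regular_on (shift v (shift v' S))\<rbrakk>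
        \<Longrightarrow> Y (shift v' S) (T_op v' x) v w = T_op v' (Y S x v (T_op (- v') w))"
    and covariance_R:
      "\<lbrakk>finite S; x \<in> W_poles_in S; \<mu> \<noteq> 0; S' = (\<lambda>z. p + \<mu> * (z - p)) ` S;
        w \<in> W_regular_on (shift (\<mu> * v) S')\<rbrakk>
        \<Longrightarrow> Y S' (R_op p \<mu> x) (\<mu> * v) w = R_op p \<mu> (Y S x v (R_op p (inverse \<mu>) w))"
    and completeness:
      "\<exists>p. W.span {fold (\<lambda>(x, v). Y {p} x v) xvs 1 | xvs.
          distinct (map snd xvs) \<and> (\<forall>(x, v) \<in> set xvs. x \<in> W_poles_in {p})} = UNIV"

end

theory Submission
  imports Defs
begin

text \<open>
  This is the skew symmetry of vertex algebras, obtained by letting both fields act on the vacuum.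
  Creation gives \<open>x2 = Y(x2, 0) 1\<close>, and creation with translation gives \<open>Y(x1, v) 1 = T\<^sub>v x1\<close>
  (\<open>Y_vacuum\<close>). Since \<open>S1 + v\<close> and \<open>S2\<close> are disjoint, locality at the vacuum yields
  \<open>Y(x1, v) x2 = Y(x1, v) Y(x2, 0) 1 = Y(x2, 0) Y(x1, v) 1 = Y(x2, 0) T\<^sub>v x1\<close>,
  and \<open>Y(x2, 0) T\<^sub>v = T\<^sub>v Y(x2, -v)\<close> by translation. Both compositions are defined because the
  translation by \<open>v\<close> carries \<open>\<^sub>SW\<close> into \<open>\<^bsub>S+v\<^esub>W\<close> (\<open>T_op_poles\<close>), and states with poles
  in \<open>S\<close> are regular on every set disjoint from \<open>S\<close> (\<open>W_poles_in_regular\<close>).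
\<close>

lemma sym_sub_mono: "U \<subseteq> V \<Longrightarrow> sym_sub U \<subseteq> sym_sub V"
proof
  fix x assume "U \<subseteq> V" "x \<in> sym_sub U"
  from this(2,1) show "x \<in> sym_sub V"
    by induction (auto intro: sym_sub.intros)
qed

lemma W_poles_in_regular:
  assumes "S \<inter> S' = {}" "x \<in> W_poles_in S"
  shows "x \<in> W_regular_on S'"
proof -
  have "K_poles_in S \<subseteq> K_regular_on S'"
    using assms(1) by (auto simp: K_poles_in_def K_regular_on_def)
  then show ?thesis
    using sym_sub_mono assms(2) by (auto simp: W_poles_in_def W_regular_on_def)
qed

lemma one_in_W_regular_on: "1 \<in> W_regular_on S"
  by (simp add: W_regular_on_def sym_sub_one)

lemma poles_translate_form: "poles (translate_form v a) = shift v (poles a)"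
proof -
  have "is_pole (coeff (translate_form v a)) z \<longleftrightarrow> is_pole (coeff a) (z - v)" for z
    using is_pole_compose_iff[OF filtermap_affine_at[of 1 "- v" z], of "coeff a"]
    by (simp add: translate_form.rep_eq o_def)
  then show ?thesis
    by (force simp: poles_def shift_def image_iff)
qed

lemmas T_op_hom = sym_map_hom[OF linear_translate_form, folded T_op_def]

lemma T_op_poles:
  assumes "x \<in> W_poles_in S"
  shows "T_op v x \<in> W_poles_in (shift v S)"
  using assms unfolding W_poles_in_def
proof induction
  case (sym_sub_gen a)
  then have "translate_form v a \<in> K_poles_in (shift v S)"
    by (auto simp: K_poles_in_def poles_translate_form shift_def)
  then show ?case
    by (simp add: T_op_hom sym_sub.sym_sub_gen)
qed (auto simp: T_op_hom intro: sym_sub.intros)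

lemma T_op_inverse:
  assumes "x \<in> sym_sub U"
  shows "T_op (- v) (T_op v x) = x"
  using assms
proof induction
  case (sym_sub_gen a)
  have "translate_form (- v) (translate_form v a) = a"
    by transfer simp
  then show ?case
    by (simp add: T_op_hom)
qed (auto simp: T_op_hom)

lemma shift_0 [simp]: "shift 0 S = S"
  by (simp add: shift_def)

context vertex_algebra_structure
begin

lemma Y_vacuum:
  assumes "finite S" "x \<in> W_poles_in S"
  shows "Y S x v 1 = T_op v x"
  using translation[OF assms one_in_W_regular_on, of 0 v] vacuum_right[OF assms]
  by (simp add: T_op_hom)

lemma skew_symmetry:
  assumes fin: "finite S1" "finite S2"
    and x1: "x1 \<in> W_poles_in S1" and x2: "x2 \<in> W_poles_in S2"
    and disj: "S2 \<inter> shift v S1 = {}"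
  shows "Y S1 x1 v x2 = T_op v (Y S2 x2 (- v) x1)"
proof -
  have reg1: "T_op v x1 \<in> W_regular_on S2"
    using W_poles_in_regular[OF _ T_op_poles[OF x1]] disj by blast
  have reg2: "x2 \<in> W_regular_on (shift v S1)"
    using W_poles_in_regular[OF disj x2] .
  have vac1: "Y S1 x1 v 1 = T_op v x1" and vac2: "Y S2 x2 0 1 = x2"
    using Y_vacuum[OF fin(1) x1] vacuum_right[OF fin(2) x2] .
  have "Y S1 x1 v x2 = Y S1 x1 v (Y S2 x2 0 1)"
    by (simp only: vac2)
  also have "\<dots> = Y S2 x2 0 (Y S1 x1 v 1)"
    using disj reg1 reg2
    by (intro locality fin x1 x2) (auto simp: vac1 vac2 one_in_W_regular_on)
  also have "\<dots> = Y S2 x2 (- v + v) (T_op v x1)"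
    by (simp add: vac1)
  also have "\<dots> = T_op v (Y S2 x2 (- v) (T_op (- v) (T_op v x1)))"
    using reg1 by (intro translation fin x2) simp
  also have "T_op (- v) (T_op v x1) = x1"
    using x1 unfolding W_poles_in_def by (rule T_op_inverse)
  finally show ?thesis .
qed

end

theorem proposition10p3:
  fixes Y :: "complex set \<Rightarrow> boson \<Rightarrow> complex \<Rightarrow> boson \<Rightarrow> boson"
    and S1 S2 :: "complex set" and x1 x2 :: boson and v :: complex
  assumes "vertex_algebra_structure Y"
    and "finite S1" and "finite S2"
    and "x1 \<in> W_poles_in S1" and "x2 \<in> W_poles_in S2"
    and "S2 \<inter> shift v S1 = {}"
  shows "Y S1 x1 v x2 = T_op v (Y S2 x2 (- v) x1)"
  using vertex_algebra_structure.skew_symmetry[OF assms] .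

end
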